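(* Let $h:\mathbb{R}^n\to\overline{\mathbb{R}}$ be a proper function and let $\overline{x}\in\arg\min_{\mathbb{R}^n}h$. Assume that $h$ is $\kappa$-quasar-convex with respect to $\overline{x}$. Then the following assertions hold: (a) If $x$ is a local minimizer of $h$, then $x\in\arg\min_{\mathbb{R}^n}h$. (b) Every local maximizer of $h$ belongs to $\arg\min_{\mathbb{R}^n}h$. In particular, $h$ has no strict local maximizers.
   Context: $\overline{\mathbb{R}}=\mathbb{R}\cup\{+\infty\}$; $\mathrm{dom}(h)=\{x\in\mathbb{R}^n:h(x)<+\infty\}$; $h$ is proper if $\mathrm{dom}(h)\neq\emptyset$; $\arg\min_{\mathbb{R}^n}h$ is the set of (global) minimizers of $h$. Let $\kappa\in(0,1]$. A proper function $h:\mathbb{R}^n\to\overline{\mathbb{R}}$ with convex domain and $\arg\min_{\mathbb{R}^n}h\neq\emptyset$ is called $\kappa$-quasar-convex with respect to $\overline{x}\in\arg\min_{\mathbb{R}^n}h$ if for all $x\in\mathrm{dom}(h)$ and all $\lambda\in[0,1]$, $$h(\lambda\overline{x}+(1-\lambda)x)\le\kappa\lambda h(\overline{x})+(1-\kappa\lambda)h(x).$$ *)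

theory Defs
  imports "HOL-Analysis.Analysis"
begin

text \<open>
  Functions with values in the reals extended by plus infinity are modelled as functions
  into \<^typ>\<open>ereal\<close>; that the value minus infinity is not attained is a separate assumption,
  to be made wherever such a function is introduced.
\<close>

definition effective_domain :: "(real^'n \<Rightarrow> ereal) \<Rightarrow> (real^'n) set" where
  "effective_domain h = {x. h x < \<infinity>}"

definition proper_fun :: "(real^'n \<Rightarrow> ereal) \<Rightarrow> bool" where
  "proper_fun h \<longleftrightarrow> effective_domain h \<noteq> {}"

definition argmin_set :: "(real^'n \<Rightarrow> ereal) \<Rightarrow> (real^'n) set" where
  "argmin_set h = {x. \<forall>y. h x \<le> h y}"

text \<open>
  In the inequality below all values of \<open>h\<close> on the right-hand side are finite (for a proper
  function that avoids minus infinity), so no convention for zero times infinity is involved.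
\<close>

definition quasar_convex :: "real \<Rightarrow> (real^'n \<Rightarrow> ereal) \<Rightarrow> real^'n \<Rightarrow> bool" where
  "quasar_convex \<kappa> h xbar \<longleftrightarrow>
     proper_fun h \<and> convex (effective_domain h) \<and> xbar \<in> argmin_set h \<and>
     (\<forall>x\<in>effective_domain h. \<forall>t\<in>{0..1::real}.
        h (t *\<^sub>R xbar + (1 - t) *\<^sub>R x)
          \<le> ereal (\<kappa> * t) * h xbar + ereal (1 - \<kappa> * t) * h x)"

text \<open>
  As usual for extended-valued functions, local minimizers and local maximizers are points
  of the domain. Otherwise every interior point of the region where \<open>h\<close> is infinite would be a
  local minimizer, and every point of that region a local maximizer. The comparison is
  with all points of a neighbourhood in the whole space, not only with those in the domain.
\<close>

definition local_minimizer :: "(real^'n \<Rightarrow> ereal) \<Rightarrow> real^'n \<Rightarrow> bool" where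
  "local_minimizer h x \<longleftrightarrow> x \<in> effective_domain h \<and> (\<forall>\<^sub>F y in nhds x. h x \<le> h y)"

definition local_maximizer :: "(real^'n \<Rightarrow> ereal) \<Rightarrow> real^'n \<Rightarrow> bool" where
  "local_maximizer h x \<longleftrightarrow> x \<in> effective_domain h \<and> (\<forall>\<^sub>F y in nhds x. h y \<le> h x)"

text \<open>
  Here no restriction to the domain is imposed, so that an isolated infinite value counts as
  a strict local maximum as well; the filter \<open>at x\<close> is the punctured neighbourhood filter.
\<close>

definition strict_local_maximizer :: "(real^'n \<Rightarrow> ereal) \<Rightarrow> real^'n \<Rightarrow> bool" where
  "strict_local_maximizer h x \<longleftrightarrow> (\<forall>\<^sub>F y in at x. h y < h x)"

end

theory Submission imports Defs begin

text \<open>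
  Everything rests on the comparison of a point \<open>z\<close> of the domain with a point
  \<open>w = t *\<^sub>R xbar + (1 - t) *\<^sub>R z\<close>, where \<open>xbar\<close> is the minimizer and \<open>0 < t \<le> 1\<close>. If
  \<open>h z \<le> h w\<close>, then quasar-convexity forces \<open>h z \<le> h xbar\<close>, because the factor \<open>\<kappa> * t\<close> is
  positive, and so \<open>w\<close> is itself a minimizer (\<open>quasar_convex_argminI\<close>).

  For a local minimizer \<open>x\<close>, take \<open>z = x\<close> and let \<open>w\<close> be slightly closer to \<open>xbar\<close>: then \<open>w\<close>
  minimizes \<open>h\<close>, and so does \<open>x\<close>, because \<open>h x \<le> h w\<close>. For a local maximizer \<open>x\<close>, take \<open>w = x\<close>
  and let \<open>z\<close> be slightly beyond \<open>x\<close> on the ray that starts at \<open>xbar\<close>.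

  A strict local maximizer at which \<open>h\<close> is finite is a local maximizer, hence a global minimizer,
  which is impossible because \<open>h\<close> takes smaller values nearby. One at which \<open>h\<close> is infinite would
  be the midpoint of two nearby points of the domain, against the convexity of the domain.
\<close>

lemma quasar_convex_argminI:
  fixes h :: "real^'n \<Rightarrow> ereal"
  assumes "0 < \<kappa>" and ninf: "\<And>x. h x \<noteq> -\<infinity>" and qc: "quasar_convex \<kappa> h xbar"
    and z: "z \<in> effective_domain h" and t: "0 < t" "t \<le> 1"
    and le: "h z \<le> h (t *\<^sub>R xbar + (1 - t) *\<^sub>R z)"
  shows "t *\<^sub>R xbar + (1 - t) *\<^sub>R z \<in> argmin_set h"
proof -
  define w where "w = t *\<^sub>R xbar + (1 - t) *\<^sub>R z"
  have xbar_min: "h xbar \<le> h y" for y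
    using qc by (auto simp: quasar_convex_def argmin_set_def)
  have hw: "h w \<le> ereal (\<kappa> * t) * h xbar + ereal (1 - \<kappa> * t) * h z"
    using qc z t by (auto simp: quasar_convex_def w_def)
  obtain c where c: "h z = ereal c"
    using z ninf[of z] by (cases "h z") (auto simp: effective_domain_def)
  obtain m where m: "h xbar = ereal m"
    using xbar_min[of z] ninf[of xbar] c by (cases "h xbar") auto
  obtain d where d: "h w = ereal d"
    using hw ninf[of w] c m by (cases "h w") auto
  have d_le: "d \<le> \<kappa> * t * m + (1 - \<kappa> * t) * c"
    using hw by (simp add: c m d)
  have "c \<le> d"
    using le by (simp add: c d flip: w_def)
  with d_le have "\<kappa> * t * c \<le> \<kappa> * t * m"
    by (simp add: algebra_simps)
  then have "c \<le> m"
    using \<open>0 < \<kappa>\<close> t by simp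
  moreover have "m \<le> c"
    using xbar_min[of z] by (simp add: c m)
  ultimately have "d \<le> m"
    using d_le by (simp add: algebra_simps)
  then have "h w \<le> h xbar"
    by (simp add: d m)
  then show ?thesis
    using xbar_min order_trans unfolding argmin_set_def w_def by blast
qed

lemma eventually_nhds_obtain_on_line:
  fixes x v :: "'a::real_normed_vector"
  assumes "eventually P (nhds x)"
  obtains s where "0 < s" "s \<le> 1" "P (x + s *\<^sub>R v)"
proof -
  have "((\<lambda>s::real. x + s *\<^sub>R v) \<longlongrightarrow> x + 0 *\<^sub>R v) (at_right 0)"
    by (intro tendsto_intros)
  then have "\<forall>\<^sub>F s in at_right 0. P (x + s *\<^sub>R v)"
    using assms by (simp add: filterlim_iff)
  moreover have "\<forall>\<^sub>F s in at_right (0::real). s \<in> {0<..<1}"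
    by (rule eventually_at_right_real) simp
  ultimately have "\<forall>\<^sub>F s in at_right 0. P (x + s *\<^sub>R v) \<and> s \<in> {0<..<1}"
    by (rule eventually_conj)
  then obtain s where "P (x + s *\<^sub>R v)" "s \<in> {0<..<1}"
    using eventually_happens'[OF trivial_limit_at_right_real] by blast
  then show ?thesis
    using that[of s] by simp
qed

lemma quasar_convex_local_minimizer:
  fixes h :: "real^'n \<Rightarrow> ereal"
  assumes "0 < \<kappa>" "\<And>x. h x \<noteq> -\<infinity>" "quasar_convex \<kappa> h xbar" "local_minimizer h x"
  shows "x \<in> argmin_set h"
proof -
  have x: "x \<in> effective_domain h" and ev: "\<forall>\<^sub>F y in nhds x. h x \<le> h y"
    using assms(4) by (auto simp: local_minimizer_def)
  obtain s where s: "0 < s" "s \<le> 1" "h x \<le> h (x + s *\<^sub>R (xbar - x))"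
    using eventually_nhds_obtain_on_line[OF ev] .
  have eq: "x + s *\<^sub>R (xbar - x) = s *\<^sub>R xbar + (1 - s) *\<^sub>R x"
    by (simp add: algebra_simps)
  have "s *\<^sub>R xbar + (1 - s) *\<^sub>R x \<in> argmin_set h"
    using quasar_convex_argminI[OF assms(1-3) x s(1,2)] s(3) by (simp only: eq)
  with s(3) show ?thesis
    unfolding eq argmin_set_def using order_trans by blast
qed

lemma quasar_convex_local_maximizer:
  fixes h :: "real^'n \<Rightarrow> ereal"
  assumes "0 < \<kappa>" "\<And>x. h x \<noteq> -\<infinity>" "quasar_convex \<kappa> h xbar" "local_maximizer h x"
  shows "x \<in> argmin_set h"
proof -
  have x: "h x < \<infinity>" and ev: "\<forall>\<^sub>F y in nhds x. h y \<le> h x"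
    using assms(4) by (auto simp: local_maximizer_def effective_domain_def)
  obtain s where s: "0 < s" "s \<le> 1" "h (x + s *\<^sub>R (x - xbar)) \<le> h x"
    using eventually_nhds_obtain_on_line[OF ev] .
  define z where "z = x + s *\<^sub>R (x - xbar)"
  \<comment> \<open>Solving the definition of \<open>z\<close> for \<open>x\<close> gives the parameter of \<open>x\<close> on the segment
    from \<open>z\<close> to \<open>xbar\<close>.\<close>
  define t where "t = s / (1 + s)"
  have t: "0 < t" "t \<le> 1"
    using s by (auto simp: t_def)
  have t1: "1 - t = inverse (1 + s)" and t2: "t = inverse (1 + s) * s"
    using s(1) by (simp_all add: t_def field_simps)
  have "t *\<^sub>R xbar + (1 - t) *\<^sub>R z = inverse (1 + s) *\<^sub>R (s *\<^sub>R xbar + z)"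
    by (simp only: t1, simp add: t2 scaleR_add_right)
  also have "s *\<^sub>R xbar + z = (1 + s) *\<^sub>R x"
    by (simp add: z_def algebra_simps)
  also have "inverse (1 + s) *\<^sub>R (1 + s) *\<^sub>R x = x"
    using s(1) by simp
  finally have eq: "t *\<^sub>R xbar + (1 - t) *\<^sub>R z = x" .
  have hz: "h z \<le> h x"
    using s(3) by (simp add: z_def)
  then have "z \<in> effective_domain h"
    using x by (auto simp: effective_domain_def dest: le_less_trans)
  from quasar_convex_argminI[OF assms(1-3) this t] hz show ?thesis
    by (simp only: eq)
qed

lemma convex_mem_if_punctured_nhds:
  fixes x :: "'a::euclidean_space"
  assumes "convex S" and ev: "\<forall>\<^sub>F y in at x. y \<in> S"
  shows "x \<in> S"
proof -
  obtain e where e: "e > 0" "\<And>y. y \<noteq> x \<Longrightarrow> dist y x < e \<Longrightarrow> y \<in> S"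
    using ev unfolding eventually_at by auto
  obtain b :: 'a where b: "b \<in> Basis"
    using nonempty_Basis by blast
  \<comment> \<open>Any short nonzero vector will do: \<open>x\<close> is the midpoint of \<open>x + v\<close> and \<open>x - v\<close>.\<close>
  define v where "v = (e / 2) *\<^sub>R b"
  have v: "v \<noteq> 0" "norm v < e"
    using e(1) b by (auto simp: v_def)
  have "x + v \<in> S" "x - v \<in> S"
    using v by (auto intro!: e(2) simp: dist_norm)
  then have "(1/2) *\<^sub>R (x + v) + (1/2) *\<^sub>R (x - v) \<in> S"
    using \<open>convex S\<close> by (intro convexD) auto
  moreover have "(1/2) *\<^sub>R (x + v) + (1/2) *\<^sub>R (x - v) = x"
    by (simp add: algebra_simps flip: scaleR_add_left)
  ultimately show ?thesis
    by simp
qed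

lemma quasar_convex_no_strict_local_maximizer:
  fixes h :: "real^'n \<Rightarrow> ereal"
  assumes "0 < \<kappa>" "\<And>x. h x \<noteq> -\<infinity>" "quasar_convex \<kappa> h xbar"
  shows "\<not> strict_local_maximizer h x"
proof
  assume "strict_local_maximizer h x"
  then have ev: "\<forall>\<^sub>F y in at x. h y < h x"
    by (simp add: strict_local_maximizer_def)
  have "\<forall>\<^sub>F y in at x. y \<in> effective_domain h"
    using ev by eventually_elim (auto simp: effective_domain_def)
  moreover have "convex (effective_domain h)"
    using assms(3) by (simp add: quasar_convex_def)
  ultimately have "x \<in> effective_domain h"
    by (intro convex_mem_if_punctured_nhds)
  moreover have "\<forall>\<^sub>F y in nhds x. h y \<le> h x"
    using ev unfolding eventually_at_filter by eventually_elim force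
  ultimately have "x \<in> argmin_set h"
    by (intro quasar_convex_local_maximizer[OF assms]) (simp add: local_maximizer_def)
  moreover obtain y where "h y < h x"
    using eventually_happens'[OF at_neq_bot ev] by blast
  ultimately show False
    by (auto simp: argmin_set_def not_le[symmetric])
qed

theorem proposition20:
  fixes h :: "real^'n \<Rightarrow> ereal" and xbar :: "real^'n" and \<kappa> :: real
  assumes "0 < \<kappa>" and "\<kappa> \<le> 1"
    and "\<And>x. h x \<noteq> -\<infinity>"
    and "proper_fun h"
    and "xbar \<in> argmin_set h"
    and "quasar_convex \<kappa> h xbar"
  shows "(\<forall>x. local_minimizer h x \<longrightarrow> x \<in> argmin_set h) \<and>
         (\<forall>x. local_maximizer h x \<longrightarrow> x \<in> argmin_set h) \<and>
         (\<nexists>x. strict_local_maximizer h x)"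
  using quasar_convex_local_minimizer[OF assms(1,3,6)]
    quasar_convex_local_maximizer[OF assms(1,3,6)]
    quasar_convex_no_strict_local_maximizer[OF assms(1,3,6)]
  by blast

end
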